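(* For three agents the partition-based strategy is optimal: for any maximum speeds $v_1, v_2, v_3 > 0$ and any $l > (v_1 + v_2 + v_3)/2$, no strategy for three agents with maximum speeds $v_1, v_2, v_3$ patrols the fence $[0, l]$.
   Context: Fence patrolling: a fence is a segment $[0,l]$ with $l>0$. There are $k$ agents $a_1,\dots,a_k$ with given maximum speeds $v_1,\dots,v_k>0$. The motion of agent $a_i$ is a function $a_i\colon[0,\infty)\to[0,l]$ satisfying $|a_i(t)-a_i(t+\epsilon)|\le v_i\epsilon$ for all $t\ge 0$, $\epsilon>0$. Agents may move in both directions and may pass each other. A strategy is a $k$-tuple $(a_1,\dots,a_k)$ of such functions. Agent $a_i$ covers the pair $(x;t^* )$ if $a_i(t)=x$ for some $t\in[t^*-1,t^* )$. A strategy patrols $[0,l]$ if for every $x\in[0,l]$ and every $t^*\in[1,\infty)$ some agent $a_i$ covers $(x;t^* )$. The partition-based strategy splits $[0,l]$ into $k$ consecutive segments of lengths proportional to $v_1,\dots,v_k$, with agent $a_i$ moving back and forth at full speed between the endpoints of the $i$-th segment; it patrols a fence of length $(v_1+\dots+v_k)/2$. *)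

theory Defs
  imports "HOL-Analysis.Analysis"
begin

text \<open>A motion of an agent with maximum speed v on the fence [0,l]:
  a function from times [0,\<infinity>) into [0,l] with speed bound v.
  Motions are modelled as functions real \<Rightarrow> real; only their values at t \<ge> 0 matter.\<close>
definition agent_motion :: "real \<Rightarrow> real \<Rightarrow> (real \<Rightarrow> real) \<Rightarrow> bool" where
  "agent_motion l v a \<longleftrightarrow>
     (\<forall>t\<ge>0. a t \<in> {0..l}) \<and>
     (\<forall>t\<ge>0. \<forall>\<epsilon>>0. \<bar>a t - a (t + \<epsilon>)\<bar> \<le> v * \<epsilon>)"

definition covers :: "(real \<Rightarrow> real) \<Rightarrow> real \<Rightarrow> real \<Rightarrow> bool" where
  "covers a x ts \<longleftrightarrow> (\<exists>t. ts - 1 \<le> t \<and> t < ts \<and> a t = x)"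

definition is_strategy :: "real \<Rightarrow> nat \<Rightarrow> (nat \<Rightarrow> real) \<Rightarrow> (nat \<Rightarrow> real \<Rightarrow> real) \<Rightarrow> bool" where
  "is_strategy l k v a \<longleftrightarrow> (\<forall>i<k. agent_motion l (v i) (a i))"

definition patrols :: "real \<Rightarrow> nat \<Rightarrow> (nat \<Rightarrow> real \<Rightarrow> real) \<Rightarrow> bool" where
  "patrols l k a \<longleftrightarrow> (\<forall>x\<in>{0..l}. \<forall>ts\<ge>1. \<exists>i<k. covers (a i) x ts)"

end

theory Submission
  imports Defs
begin

text \<open>
  The basic tool is confinement: an agent of speed \<open>v\<close> that alone has to serve a point \<open>p\<close> cannot
  visit points farther than \<open>v/2\<close> from \<open>p\<close>. Conversely, an agent at \<open>q\<close> at time \<open>t\<close> leaves every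
  point \<open>x\<close> to the others during \<open>(t - \<bar>x - q\<bar>/v, t + \<bar>x - q\<bar>/v)\<close>.

  Scale so that the fastest agent \<open>f\<close> has speed 1, and let \<open>g\<close>, \<open>h\<close> have speeds \<open>\<alpha>\<close>, \<open>\<beta>\<close>.
  If \<open>g\<close> and \<open>h\<close> visited the same end of the fence within unit time, \<open>f\<close> alone would have to serve
  the far end and a point at distance more than 1/2 from it, which is impossible. So while \<open>f\<close> is away
  from an end, a single slow agent serves that end. An end cannot be left to one slow agent forever
  (the other two would patrol the rest, contradicting the bound for two agents), so \<open>f\<close> visits both
  ends infinitely often. While \<open>f\<close> travels from the right end to the left end and back, one slow agent,
  say \<open>h\<close>, serves the right end alone and the other one, \<open>g\<close>, shares the left end with \<open>f\<close>.
  Counting the times at which the points at distance more than 1/2 from the left end can be served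
  shows that \<open>h\<close> must be strictly faster than \<open>g\<close>. The mirror image of this argument at the next
  visit of \<open>f\<close> to the right end shows that \<open>g\<close> must be strictly faster than \<open>h\<close>.
\<close>

section \<open>Service windows and confinement\<close>

text \<open>Time starts at 0, so positions at negative times are disregarded.\<close>

definition avoids :: "(real \<Rightarrow> real) \<Rightarrow> real \<Rightarrow> real \<Rightarrow> real \<Rightarrow> bool" where
  "avoids a x s t \<longleftrightarrow> (\<forall>u. 0 \<le> u \<and> s < u \<and> u < t \<longrightarrow> a u \<noteq> x)"

text \<open>Windows are indexed by their left end \<open>u\<close>, which is \<open>ts - 1\<close>
  in \<open>covers\<close>. The start \<open>T\<close> allows claims that hold only from some time
  on.\<close>

definition serves :: "(real \<Rightarrow> real) set \<Rightarrow> real \<Rightarrow> real \<Rightarrow> bool" where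
  "serves A x T \<longleftrightarrow> (\<forall>u\<ge>T. \<exists>t. u \<le> t \<and> t < u + 1 \<and> (\<exists>a\<in>A. a t = x))"

lemma avoidsD: "avoids a x s t \<Longrightarrow> 0 \<le> u \<Longrightarrow> s < u \<Longrightarrow> u < t \<Longrightarrow> a u \<noteq> x"
  by (simp add: avoids_def)

lemma avoids_subset: "avoids a x s t \<Longrightarrow> s \<le> s' \<Longrightarrow> t' \<le> t \<Longrightarrow> avoids a x s' t'"
  by (auto simp: avoids_def)

lemma all_avoid_imp_short:
  assumes "serves A x T" "T \<le> s" "0 \<le> s" "\<And>a. a \<in> A \<Longrightarrow> avoids a x s t"
  shows "t - s \<le> 1"
proof (rule ccontr)
  assume "\<not> t - s \<le> 1"
  then obtain u where u: "s < u" "u + 1 < t"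
    using dense[of s "t - 1"] by auto
  then obtain w a where "u \<le> w" "w < u + 1" "a \<in> A" "a w = x"
    using assms(1,2) unfolding serves_def by (meson less_eq_real_def order_trans)
  then show False
    using assms(3) assms(4)[of a] u by (auto simp: avoids_def)
qed

lemma avoids_around:
  assumes "v-lipschitz_on {0..} a" "0 < v" "0 \<le> u" "d \<le> \<bar>x - a u\<bar> / v"
  shows "avoids a x (u - d) (u + d)"
  unfolding avoids_def
proof (intro allI impI notI)
  fix w assume w: "0 \<le> w \<and> u - d < w \<and> w < u + d" and "a w = x"
  then have "\<bar>x - a u\<bar> \<le> v * \<bar>w - u\<bar>"
    using lipschitz_onD[OF assms(1), of w u] assms(3) by (simp add: dist_real_def)
  then have "d \<le> \<bar>w - u\<bar>"
    using assms(2,4) by (smt (verit) mult.commute pos_divide_le_eq)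
  then show False using w by linarith
qed

text \<open>A visit of \<open>a\<close> to \<open>x\<close> at time \<open>u\<close> keeps it from
  \<open>p\<close> during \<open>(u - d, u + d)\<close>. For \<open>u\<close> in the stated range
  this overlaps \<open>(s, t)\<close> in more than unit time.\<close>

lemma confinement:
  assumes "serves A p T" "T \<le> s" "0 \<le> s" "1 < t - s"
    and "v-lipschitz_on {0..} a" "0 < v" "d \<le> \<bar>x - p\<bar> / v" "1 < 2 * d"
    and "\<And>b. b \<in> A \<Longrightarrow> b \<noteq> a \<Longrightarrow> avoids b p s t"
  shows "avoids a x (s + 1 - d) (t - 1 + d)"
  unfolding avoids_def
proof (intro allI impI notI)
  fix u assume u: "0 \<le> u \<and> s + 1 - d < u \<and> u < t - 1 + d" and "a u = x"
  then have "avoids a p (u - d) (u + d)"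
    using assms by (intro avoids_around) (auto simp: abs_minus_commute)
  then have "\<And>b. b \<in> A \<Longrightarrow> avoids b p (max s (u - d)) (min t (u + d))"
    using assms(9) by (metis avoids_subset max.cobounded1 max.cobounded2 min.cobounded1 min.cobounded2)
  from all_avoid_imp_short[OF assms(1) _ _ this]
  have "min t (u + d) - max s (u - d) \<le> 1" using assms(2,3) by simp
  then show False using assms(4,8) u by (simp add: max_def min_def split: if_splits)
qed

text \<open>Serving \<open>p\<close> alone keeps \<open>f\<close> from \<open>w\<close> during a
  range that contains \<open>(s, t)\<close> because \<open>1 < 2 * d\<close>; so nobody serves
  \<open>w\<close> there.\<close>

lemma fast_agent_fails:
  assumes "serves A p T" "serves A w T" "0 \<le> T" "T \<le> s - d" "1 < t - s"
    and "v-lipschitz_on {0..} f" "0 < v" "d \<le> \<bar>w - p\<bar> / v" "1 < 2 * d"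
    and "\<And>b. b \<in> A \<Longrightarrow> b \<noteq> f \<Longrightarrow> avoids b w s t \<and> avoids b p (s - d) (t + d)"
  shows False
proof -
  have "avoids f w (s - d + 1 - d) (t + d - 1 + d)"
    using assms by (intro confinement[OF assms(1), where v = v]) auto
  then have "avoids f w s t"
    by (rule avoids_subset) (use assms(9) in auto)
  then have "\<And>b. b \<in> A \<Longrightarrow> avoids b w s t"
    using assms(10) by metis
  from all_avoid_imp_short[OF assms(2) _ _ this] show False
    using assms by simp
qed

section \<open>Two agents\<close>

lemma slow_agent_misses_end:
  assumes lip: "v-lipschitz_on {0..} f" "w-lipschitz_on {0..} g" and "0 < w" "w \<le> v"
    and dist: "(v + w) / 2 < \<bar>q - p\<bar>"
    and serv: "\<And>x. x \<in> closed_segment p q \<Longrightarrow> serves {f, g} x T" and "0 \<le> T"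
    and t: "T + \<bar>q - p\<bar> / w \<le> t"
  shows "g t \<noteq> q"
proof
  assume gt: "g t = q"
  \<comment> \<open>\<open>e\<close> puts \<open>y\<close> more than \<open>v / 2\<close> from
    \<open>p\<close>, too far for \<open>f\<close>, and more than \<open>w / 2\<close> from
    \<open>q\<close>, so that a visit of \<open>g\<close> to \<open>q\<close> keeps it from
    \<open>y\<close> for more than unit time.\<close>
  obtain e where e: "v / 2 < e" "e < \<bar>q - p\<bar> - w / 2"
    using dist dense[of "v/2" "\<bar>q - p\<bar> - w / 2"] by (auto simp: field_simps)
  define y where "y = (if p \<le> q then p + e else p - e)"
  have e0: "0 < e" "e < \<bar>q - p\<bar>" using e assms(3,4) by auto
  have y: "\<bar>y - p\<bar> = e" "\<bar>q - y\<bar> = \<bar>q - p\<bar> - e" "y \<in> closed_segment p q"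
    using e0 by (auto simp: y_def closed_segment_eq_real_ivl)
  have evw: "e / v \<le> e / w" using e0 assms(3,4) by (simp add: frac_le)
  have t0: "0 \<le> t" using t assms(3) \<open>0 \<le> T\<close> by (smt (verit) divide_nonneg_pos)
  define D where "D = (\<bar>q - p\<bar> - e) / w"
  have D: "1 < 2 * D" using e assms(3) by (simp add: D_def field_simps)
  have De: "D + e / w = \<bar>q - p\<bar> / w"
    by (simp add: D_def diff_divide_distrib)
  have a1: "avoids g y (t - D) (t + D)"
    by (rule avoids_around[OF lip(2) \<open>0 < w\<close> t0])
       (simp add: gt D_def y(2) abs_minus_commute[of y])
  have a2: "avoids g p (t - \<bar>q - p\<bar> / w) (t + \<bar>q - p\<bar> / w)"
    by (rule avoids_around[OF lip(2) \<open>0 < w\<close> t0]) (simp add: gt abs_minus_commute)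
  have a3: "avoids g p (t - D - e / v) (t + D + e / v)"
    by (rule avoids_subset[OF a2]) (use De evw in linarith)+
  have ev: "1 < 2 * (e / v)" using e assms(3,4) by (simp add: field_simps)
  show False
    by (rule fast_agent_fails[where A = "{f, g}" and p = p and w = y and T = T and s = "t - D"
          and t = "t + D" and v = v and f = f and d = "e / v"])
       (use serv y a1 a3 lip ev D De evw t assms(3,4) \<open>0 \<le> T\<close> in auto)
qed

text \<open>Eventually the slow agent visits neither end, and \<open>f\<close> alone must serve two
  ends more than \<open>v / 2\<close> apart.\<close>

lemma two_agents_cannot_patrol:
  assumes lip: "v-lipschitz_on {0..} f" "w-lipschitz_on {0..} g" and vw: "0 < w" "w \<le> v"
    and len: "(v + w) / 2 < q - p"
    and serv: "\<And>x. p \<le> x \<Longrightarrow> x \<le> q \<Longrightarrow> serves {f, g} x T" and T: "0 \<le> T"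
  shows False
proof -
  have pq: "p < q" using len vw by auto
  define T' where "T' = T + (q - p) / w"
  have T': "T \<le> T'" "0 \<le> T'" using pq vw T by (auto simp: T'_def)
  have "g t \<noteq> q" if "T' \<le> t" for t
    by (rule slow_agent_misses_end[OF lip vw, of q p T])
       (use that pq len serv T in \<open>auto simp: closed_segment_eq_real_ivl T'_def\<close>)
  moreover have "g t \<noteq> p" if "T' \<le> t" for t
    by (rule slow_agent_misses_end[OF lip vw, of p q T])
       (use that pq len serv T in \<open>auto simp: closed_segment_eq_real_ivl T'_def\<close>)
  ultimately have g: "avoids g q T' t \<and> avoids g p T' t" for t
    by (simp add: avoids_def)
  define d where "d = (q - p) / v"
  have d: "1 < 2 * d" using len vw by (simp add: d_def field_simps)
  show False
    by (rule fast_agent_fails[where A = "{f, g}" and p = p and w = q and T = T and s = "T' + d"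
          and t = "T' + d + 2" and v = v and f = f and d = d])
       (use lip pq vw T T' serv d g in \<open>auto simp: d_def intro: avoids_subset[where s = T']\<close>)
qed

section \<open>First and last visits\<close>

lemma compact_visits:
  fixes a :: "real \<Rightarrow> real"
  assumes "v-lipschitz_on {0..} a" "0 \<le> s"
  shows "compact {u \<in> {s..t}. a u = x}"
proof -
  have "continuous_on {s..t} a"
    by (rule continuous_on_subset[OF lipschitz_on_continuous_on[OF assms(1)]]) (use assms(2) in auto)
  then have "closed {u \<in> {s..t}. a u = x}"
    by (intro continuous_closed_preimage_constant) auto
  moreover have "bounded {u \<in> {s..t}. a u = x}"
    by (rule bounded_subset[of "{s..t}"]) auto
  ultimately show ?thesis by (simp add: compact_eq_bounded_closed)
qed

lemma first_visit:
  fixes a :: "real \<Rightarrow> real"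
  assumes "v-lipschitz_on {0..} a" "0 \<le> s" "s \<le> u" "a u = x"
  obtains m where "s \<le> m" "m \<le> u" "a m = x" "\<And>w. s \<le> w \<Longrightarrow> w < m \<Longrightarrow> a w \<noteq> x"
proof -
  let ?S = "{w \<in> {s..u}. a w = x}"
  have "u \<in> ?S" using assms by simp
  then have "?S \<noteq> {}" by blast
  then obtain m where m: "m \<in> ?S" "\<And>w. w \<in> ?S \<Longrightarrow> m \<le> w"
    using compact_attains_inf[OF compact_visits[OF assms(1,2)]] by metis
  show ?thesis
  proof (rule that[of m])
    fix w assume "s \<le> w" "w < m"
    then show "a w \<noteq> x" using m(1) m(2)[of w] by auto
  qed (use m(1) in auto)
qed

lemma last_visit:
  fixes a :: "real \<Rightarrow> real"
  assumes "v-lipschitz_on {0..} a" "0 \<le> u" "u \<le> t" "a u = x"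
  obtains m where "u \<le> m" "m \<le> t" "a m = x" "\<And>w. m < w \<Longrightarrow> w \<le> t \<Longrightarrow> a w \<noteq> x"
proof -
  let ?S = "{w \<in> {u..t}. a w = x}"
  have "u \<in> ?S" using assms by simp
  then have "?S \<noteq> {}" by blast
  then obtain m where m: "m \<in> ?S" "\<And>w. w \<in> ?S \<Longrightarrow> w \<le> m"
    using compact_attains_sup[OF compact_visits[OF assms(1,2)]] by metis
  show ?thesis
  proof (rule that[of m])
    fix w assume "m < w" "w \<le> t"
    then show "a w \<noteq> x" using m(1) m(2)[of w] by auto
  qed (use m(1) in auto)
qed


section \<open>Three agents with fastest speed 1, and the symmetries of the situation\<close>

locale three_agents =
  fixes l \<alpha> \<beta> :: real and f g h :: "real \<Rightarrow> real"
  assumes \<alpha>: "0 < \<alpha>" "\<alpha> \<le> 1" and \<beta>: "0 < \<beta>" "\<beta> \<le> 1"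
    and long: "(1 + \<alpha> + \<beta>) / 2 < l"
    and f: "1-lipschitz_on {0..} f" and g: "\<alpha>-lipschitz_on {0..} g" and h: "\<beta>-lipschitz_on {0..} h"
    and served: "\<And>x. 0 \<le> x \<Longrightarrow> x \<le> l \<Longrightarrow> serves {f, g, h} x 0"
begin

lemma swap: "three_agents l \<beta> \<alpha> f h g"
  using \<alpha> \<beta> long f g h served by unfold_locales (auto simp: insert_commute)

lemma reflect: "three_agents l \<alpha> \<beta> (\<lambda>t. l - f t) (\<lambda>t. l - g t) (\<lambda>t. l - h t)"
proof unfold_locales
  fix x assume x: "0 \<le> x" "x \<le> l"
  have "(l - y = x) = (y = l - x)" for y by auto
  then show "serves {\<lambda>t. l - f t, \<lambda>t. l - g t, \<lambda>t. l - h t} x 0"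
    using served[of "l - x"] x by (simp add: serves_def)
qed (use \<alpha> \<beta> long f g h in \<open>auto simp: lipschitz_on_def dist_real_def abs_minus_commute\<close>)

lemma reflect_avoids: "avoids (\<lambda>t. l - a t) (l - x) s t = avoids a x s t"
  by (auto simp: avoids_def)

lemma l_gt: "1 / 2 < l" "\<alpha> / 2 < l" "\<beta> / 2 < l" "0 < l" "l \<le> l / \<alpha>" "l \<le> l / \<beta>" "0 < l / \<alpha>" "0 < l / \<beta>"
proof -
  show l: "1 / 2 < l" "\<alpha> / 2 < l" "\<beta> / 2 < l" "0 < l" using \<alpha> \<beta> long by auto
  then show "l \<le> l / \<alpha>" "l \<le> l / \<beta>" using \<alpha> \<beta> by (auto simp: le_divide_eq mult_left_le)
  show "0 < l / \<alpha>" "0 < l / \<beta>" using l \<alpha> \<beta> by auto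
qed

section \<open>Which agents serve an end\<close>

text \<open>Slow agents that both come to \<open>q\<close> leave the far end \<open>p\<close> and a
  point more than 1/2 from it to \<open>f\<close> alone. The bound
  \<open>l / \<alpha> \<le> t\<close> keeps the times used nonnegative.\<close>

lemma slow_agents_not_together:
  assumes "p = 0 \<and> q = l \<or> p = l \<and> q = 0" "g t = q" "h u = q" "\<bar>t - u\<bar> \<le> 1" "l / \<alpha> \<le> t" "0 \<le> u"
  shows False
proof -
  obtain e where e: "1 / 2 < e" "e < l - (\<alpha> + \<beta>) / 2"
    using dense[of "1/2" "l - (\<alpha> + \<beta>) / 2"] long by (auto simp: field_simps)
  define y where "y = (if p = 0 then e else l - e)"
  have el: "0 < e" "e < l" using e \<alpha>(1) \<beta>(1) by (simp_all add: field_simps)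
  have y: "\<bar>y - p\<bar> = e" "\<bar>q - y\<bar> = l - e" "\<bar>q - p\<bar> = l" "0 \<le> y" "y \<le> l" "0 \<le> p" "p \<le> l"
    using assms(1) el by (auto simp: y_def)
  define D where "D = l - e"
  have D: "(\<alpha> + \<beta>) / 2 < D" using e unfolding D_def by argo
  have eab: "e \<le> e / \<alpha>" "e \<le> e / \<beta>" using el \<alpha> \<beta> by (auto simp: le_divide_eq mult_left_le)
  have De: "D / \<alpha> + e / \<alpha> = l / \<alpha>" "D / \<beta> + e / \<beta> = l / \<beta>"
    by (simp_all add: D_def diff_divide_distrib)
  have t0: "0 \<le> t" using assms(5) l_gt by linarith
  define s where "s = max (t - D / \<alpha>) (u - D / \<beta>)"
  define s' where "s' = min (t + D / \<alpha>) (u + D / \<beta>)"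
  have g1: "avoids g y (t - D / \<alpha>) (t + D / \<alpha>)"
    by (rule avoids_around[OF g \<alpha>(1) t0]) (simp add: assms(2) y D_def abs_minus_commute[of y])
  have g2: "avoids g p (t - l / \<alpha>) (t + l / \<alpha>)"
    by (rule avoids_around[OF g \<alpha>(1) t0]) (simp add: assms(2) y abs_minus_commute[of p])
  have h1: "avoids h y (u - D / \<beta>) (u + D / \<beta>)"
    by (rule avoids_around[OF h \<beta>(1) assms(6)]) (simp add: assms(3) y D_def abs_minus_commute[of y])
  have h2: "avoids h p (u - l / \<beta>) (u + l / \<beta>)"
    by (rule avoids_around[OF h \<beta>(1) assms(6)]) (simp add: assms(3) y abs_minus_commute[of p])
  have g': "avoids g y s s' \<and> avoids g p (s - e) (s' + e)"
    using De eab unfolding s_def s'_def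
    by (intro conjI avoids_subset[OF g1] avoids_subset[OF g2]) auto
  have h': "avoids h y s s' \<and> avoids h p (s - e) (s' + e)"
    using De eab unfolding s_def s'_def
    by (intro conjI avoids_subset[OF h1] avoids_subset[OF h2]) auto
  have D2: "1 < 2 * (D / \<alpha>)" "1 < 2 * (D / \<beta>)"
    using D \<alpha> \<beta> by (auto simp: field_simps)
  \<comment> \<open>The means inequality for the two speeds gives
    \<open>2 < D / \<alpha> + D / \<beta>\<close>: the absences of \<open>g\<close> and
    \<open>h\<close> from \<open>y\<close> overlap in more than unit time even if \<open>t\<close>
    and \<open>u\<close> differ by 1.\<close>
  have "2 * (2 * \<alpha> * \<beta>) \<le> (\<alpha> + \<beta>) * (\<alpha> + \<beta>)"
    using zero_le_power2[of "\<alpha> - \<beta>"] by (simp add: power2_eq_square algebra_simps)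
  also have "\<dots> < 2 * D * (\<alpha> + \<beta>)"
    using D \<alpha> \<beta> by (intro mult_strict_right_mono) auto
  finally have D3: "2 < D / \<alpha> + D / \<beta>"
    using \<alpha> \<beta> by (simp add: field_simps)
  have "1 < s' - s" using D2 D3 assms(4) unfolding s_def s'_def by linarith
  moreover have "0 \<le> s - e" using assms(5) De eab by (simp add: s_def max_def)
  ultimately show False
    by (intro fast_agent_fails[where A = "{f, g, h}" and p = p and w = y and T = 0 and s = s
          and t = s' and v = 1 and f = f and d = e])
       (use y served f e g' h' in auto)
qed

text \<open>Between the last visit of \<open>g\<close> and the next one of \<open>h\<close> nobody
  is at \<open>p\<close>, so these visits are within unit time of each other.\<close>

lemma no_switch_le:
  assumes "p = 0 \<or> p = l" "avoids f p s t" "l / \<alpha> \<le> s" "s < u" "u \<le> u'" "u' < t" "g u = p" "h u' = p"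
  shows False
proof -
  have u: "0 \<le> u" using assms l_gt by linarith
  obtain r where r: "u \<le> r" "r \<le> u'" "g r = p" "\<And>w. r < w \<Longrightarrow> w \<le> u' \<Longrightarrow> g w \<noteq> p"
    using last_visit[OF g u assms(5) assms(7)] by metis
  have "0 \<le> r" using u r by simp
  then obtain r' where r': "r \<le> r'" "r' \<le> u'" "h r' = p" "\<And>w. r \<le> w \<Longrightarrow> w < r' \<Longrightarrow> h w \<noteq> p"
    using first_visit[OF h _ r(2) assms(8)] by metis
  have "r' - r \<le> 1"
    by (rule all_avoid_imp_short[of "{f, g, h}" p 0])
       (use assms l_gt served[of p] r r' u in \<open>auto simp: avoids_def\<close>)
  then show False
    using slow_agents_not_together[of "l - p" p r r'] assms r r' l_gt by auto
qed

lemma no_switch: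
  assumes "p = 0 \<or> p = l" "avoids f p s t" "l / \<alpha> + l / \<beta> \<le> s"
  shows "avoids g p s t \<or> avoids h p s t"
proof (rule ccontr)
  assume "\<not> ?thesis"
  then obtain u u' where u: "s < u" "u < t" "g u = p" "s < u'" "u' < t" "h u' = p"
    by (auto simp: avoids_def)
  show False
  proof (cases "u \<le> u'")
    case True then show False using no_switch_le[of p s t u u'] assms u l_gt by auto
  next
    case False then show False
      using three_agents.no_switch_le[OF swap, of p s t u' u] assms u l_gt by auto
  qed
qed

text \<open>Alone at 0, \<open>g\<close> is confined to distance \<open>\<alpha> / 2\<close> from it
  after \<open>S + 1\<close>, which leaves \<open>f\<close> and \<open>h\<close> a segment too long
  for two agents.\<close>

lemma end_not_left_to_one_slow_agent:
  assumes "0 \<le> S" "\<And>t. S < t \<Longrightarrow> f t \<noteq> 0" "\<And>t. S < t \<Longrightarrow> h t \<noteq> 0"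
  shows False
proof -
  obtain p where p: "\<alpha> / 2 < p" "p < l - (1 + \<beta>) / 2"
    using dense[of "\<alpha>/2" "l - (1 + \<beta>) / 2"] long by (auto simp: field_simps)
  have "serves {f, h} x (S + 1)" if x: "p \<le> x" "x \<le> l" for x
  proof -
    define d where "d = x / \<alpha>"
    have x0: "0 < x" using x p \<alpha> by auto
    have d: "1 < 2 * d" using x p \<alpha> by (simp add: d_def field_simps)
    have *: "avoids g x (S + 1 - d) (t - 1 + d)" if "S + 1 < t" for t
      by (rule confinement[OF served[of 0], where v = \<alpha>])
         (use assms that x0 d g \<alpha> l_gt in \<open>auto simp: d_def avoids_def\<close>)
    have g: "g t \<noteq> x" if "S + 1 \<le> t" for t
      using avoidsD[OF *[of "t + 1"], of t] that d assms(1) by auto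
    have "serves {f, g, h} x 0" using served x x0 by simp
    then have "\<exists>t\<ge>u. t < u + 1 \<and> (f t = x \<or> g t = x \<or> h t = x)" if "0 \<le> u" for u
      using that by (simp add: serves_def)
    then show ?thesis
      unfolding serves_def using g assms(1)
      by (smt (verit, ccfv_SIG) insert_iff)
  qed
  moreover have "(1 + \<beta>) / 2 < l - p" using p by argo
  ultimately show False
    using two_agents_cannot_patrol[OF f h, of l p "S + 1"] \<beta> assms(1) by simp
qed

lemma fast_agent_visits_left_end: "\<exists>t\<ge>T. f t = 0"
proof (rule ccontr)
  assume "\<not> ?thesis"
  then have fT: "\<And>t. T \<le> t \<Longrightarrow> f t \<noteq> 0" by auto
  define S where "S = max T (l / \<alpha> + l / \<beta>)"
  have S: "0 \<le> S" "T \<le> S" "l / \<alpha> + l / \<beta> \<le> S" using l_gt by (auto simp: S_def)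
  have *: "avoids g 0 S t \<or> avoids h 0 S t" for t
    by (rule no_switch) (use S fT in \<open>auto simp: avoids_def\<close>)
  \<comment> \<open>The absent agent in \<open>*\<close> may depend on \<open>t\<close>; an interval
    containing both offending visits makes the choice uniform.\<close>
  have "(\<forall>t>S. g t \<noteq> 0) \<or> (\<forall>t>S. h t \<noteq> 0)"
  proof (rule ccontr)
    assume "\<not> ?thesis"
    then obtain t t' where "S < t" "g t = 0" "S < t'" "h t' = 0" by auto
    then show False using *[of "max t t' + 1"] S(1) by (auto simp: avoids_def)
  qed
  then show False
    using end_not_left_to_one_slow_agent[of S]
      three_agents.end_not_left_to_one_slow_agent[OF swap, of S] S fT by fastforce
qed

lemma fast_agent_visits_right_end: "\<exists>t\<ge>T. f t = l"
  using three_agents.fast_agent_visits_left_end[OF reflect, of T] by auto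

section \<open>Comparing the speeds of the slow agents\<close>

text \<open>
  Let \<open>M\<close> be the rightmost position of \<open>g\<close> between its visits \<open>r\<close>, \<open>r'\<close> to the left end. Going there
  and back takes \<open>2 M / \<alpha> \<le> r' - r \<le> t2 - t1 + 2\<close>, whereas serving the points just right
  of \<open>M\<close> forces \<open>h\<close> away from the right end, which bounds \<open>t2 - t1\<close> from above. For \<open>\<beta> \<le> \<alpha>\<close> the
  two bounds are incompatible.
\<close>

lemma slower_agent_overloaded:
  assumes ord: "r \<le> t1" "t1 \<le> t2" "t2 \<le> r'" "t1 - r \<le> 1" "r' - t2 \<le> 1" "1 \<le> t1" "l \<le> t1"
    and ends: "f t1 = 0" "f t2 = 0" "g r = 0" "g r' = 0"
    and left: "avoids g 0 r r'" "avoids h 0 r r'"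
    and right: "avoids f l (t1 - l) (t2 + l)" "avoids g l (t1 - l) (t2 + l)"
  shows "\<alpha> < \<beta>"
proof (rule ccontr)
  assume "\<not> \<alpha> < \<beta>"
  then have \<beta>\<alpha>: "\<beta> \<le> \<alpha>" by simp
  have pos: "0 \<le> r" "0 \<le> r'" "0 \<le> t1" "0 \<le> t2" using ord by auto
  \<comment> \<open>Near \<open>t1\<close> and \<open>t2\<close> the speed bound suffices; in
    between, \<open>f\<close> alone serves 0 and is confined.\<close>
  have F: "avoids f x (t1 - x) (t2 + x)" if x: "1 / 2 < x" "x \<le> l" for x
  proof -
    have 1: "avoids f x (t1 - x) (t1 + x)" "avoids f x (t2 - x) (t2 + x)"
      using x ends by (auto intro!: avoids_around[OF f] pos)
    have 2: "avoids f x (r + 1 - x) (r' - 1 + x)" if "1 < r' - r"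
      by (rule confinement[OF served[of 0], where v = 1])
         (use x f left l_gt that pos in auto)
    show ?thesis
      unfolding avoids_def
    proof (intro allI impI)
      fix u assume u: "0 \<le> u \<and> t1 - x < u \<and> u < t2 + x"
      show "f u \<noteq> x"
      proof (cases "u < t1 + x \<or> t2 - x < u")
        case True
        then show ?thesis using u avoidsD[OF 1(1), of u] avoidsD[OF 1(2), of u] by auto
      next
        case False
        then show ?thesis using avoidsD[OF 2, of u] u x ord by auto
      qed
    qed
  qed
  have H: "avoids h x (t1 - l + 1 - (l - x) / \<beta>) (t2 + l - 1 + (l - x) / \<beta>)" if "x < l - \<beta> / 2" for x
    by (rule confinement[OF served[of l], where v = \<beta>])
       (use that \<beta> h right l_gt ord in \<open>auto simp: field_simps\<close>)
  have "continuous_on {r..r'} g"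
    by (rule continuous_on_subset[OF lipschitz_on_continuous_on[OF g]]) (use pos in auto)
  then obtain s where s: "r \<le> s" "s \<le> r'" and max: "\<And>u. r \<le> u \<Longrightarrow> u \<le> r' \<Longrightarrow> g u \<le> g s"
    using continuous_attains_sup[of "{r..r'}" g] ord by auto
  define M where "M = g s"
  have M0: "0 \<le> M" using max[of r] ends ord by (simp add: M_def)
  have "M \<le> \<alpha> * (s - r)" "M \<le> \<alpha> * (r' - s)"
    using lipschitz_onD[OF g, of s r] lipschitz_onD[OF g, of r' s] s pos ends M0
    by (auto simp: dist_real_def M_def)
  then have sM: "M / \<alpha> \<le> s - r" "M / \<alpha> \<le> r' - s"
    using \<alpha> by (auto simp: field_simps)
  have G: "avoids g x (t1 - x) (t2 + x)" if "M < x" for x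
  proof -
    have x: "0 < x" "x \<le> x / \<alpha>" using that M0 \<alpha> by (auto simp: le_divide_eq mult_left_le)
    have 1: "avoids g x (r - x) (r + x)" "avoids g x (r' - x) (r' + x)"
      using x ends by (auto intro!: avoids_around[OF g] pos \<alpha>)
    show ?thesis
      unfolding avoids_def
    proof (intro allI impI)
      fix u assume u: "0 \<le> u \<and> t1 - x < u \<and> u < t2 + x"
      then show "g u \<noteq> x"
        using avoidsD[OF 1(1), of u] avoidsD[OF 1(2), of u] max[of u] that ord x
        unfolding M_def by (cases "r \<le> u"; cases "u \<le> r'") auto
    qed
  qed
  \<comment> \<open>Here \<open>\<beta> \<le> \<alpha>\<close> enters: \<open>l - p\<close> exceeds
    \<open>(\<alpha> + \<beta>) / 2 \<ge> \<beta>\<close>, so \<open>h\<close> needs at least unit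
    time between \<open>l\<close> and \<open>p\<close>.\<close>
  have H': "avoids h p (t1 - p) (t2 + p)" if "1 / 2 < p" "p < l - (\<alpha> + \<beta>) / 2" for p
  proof -
    have "1 \<le> (l - p) / \<beta>" using that \<beta>\<alpha> \<beta> by (simp add: field_simps)
    moreover have "p < l - \<beta> / 2" "p \<le> l" using that \<alpha>(1) \<beta>(1) by argo+
    ultimately show ?thesis
      by (intro avoids_subset[OF H]) auto
  qed
  have M1: "1 / 2 \<le> M"
  proof (rule ccontr)
    assume M: "\<not> 1 / 2 \<le> M"
    obtain p where p: "1 / 2 < p" "p < l - (\<alpha> + \<beta>) / 2"
      using dense[of "1/2" "l - (\<alpha> + \<beta>) / 2"] long by (auto simp: field_simps)
    have pl: "p \<le> l" using p \<alpha>(1) \<beta>(1) by argo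
    have "(t2 + p) - (t1 - p) \<le> 1"
      by (rule all_avoid_imp_short[OF served[of p]])
         (use p pl M ord F[of p] G[of p] H'[of p] in auto)
    then show False using p ord by auto
  qed
  \<comment> \<open>Otherwise \<open>g\<close> alone serves some \<open>p\<close> in
    \<open>(1 / 2, M - \<alpha> / 2)\<close> around time \<open>s\<close>, and confinement forbids
    its being at \<open>M\<close> then.\<close>
  have M2: "M \<le> 1 / 2 + \<alpha> / 2"
  proof (rule ccontr)
    assume M: "\<not> M \<le> 1 / 2 + \<alpha> / 2"
    then have "1 / 2 < min (M - \<alpha> / 2) (l - (\<alpha> + \<beta>) / 2)"
      using long by (auto simp: field_simps)
    then obtain p where p: "1 / 2 < p" "p < M - \<alpha> / 2" "p < l - (\<alpha> + \<beta>) / 2"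
      using dense[of "1/2"] by (metis min_less_iff_conj)
    have pl: "p \<le> l" using p \<alpha>(1) \<beta>(1) by argo
    define d where "d = (M - p) / \<alpha>"
    have d: "1 < 2 * d" using p \<alpha> by (simp add: d_def field_simps)
    have Md: "M / \<alpha> = d + p / \<alpha>" by (simp add: d_def diff_divide_distrib)
    have p\<alpha>: "p \<le> p / \<alpha>" using p \<alpha> by (auto simp: le_divide_eq mult_left_le)
    have "avoids g M (t1 - p + 1 - d) (t2 + p - 1 + d)"
      by (rule confinement[OF served[of p], where v = \<alpha>])
         (use p pl ord d g \<alpha> F[of p] H'[of p] in \<open>auto simp: d_def\<close>)
    then have "g s \<noteq> M"
      by (rule avoidsD) (use sM s pos ord Md p\<alpha> p d in linarith)+
    then show False by (simp add: M_def)
  qed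
  \<comment> \<open>Nobody is at \<open>x\<close> during
    \<open>(t1 - min x j, t2 + min x j)\<close>; since \<open>1 / 2 < x\<close>, the minimum must be
    \<open>j\<close>.\<close>
  have key: "t2 - t1 + 2 * (l - 1) + 2 * ((l - x) / \<beta>) \<le> 1" if x: "M < x" "x < l - \<beta> / 2" for x
  proof -
    define j where "j = l - 1 + (l - x) / \<beta>"
    have xl: "x \<le> l" using x \<beta>(1) by argo
    have x1: "1 / 2 < x" using x M1 by simp
    have "avoids f x (t1 - min x j) (t2 + min x j)"
      by (rule avoids_subset[OF F[OF x1 xl]]) auto
    moreover have "avoids g x (t1 - min x j) (t2 + min x j)"
      by (rule avoids_subset[OF G[OF x(1)]]) auto
    moreover have "avoids h x (t1 - min x j) (t2 + min x j)"
      by (rule avoids_subset[OF H[OF x(2)]]) (auto simp: j_def)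
    ultimately have "(t2 + min x j) - (t1 - min x j) \<le> 1"
      by (intro all_avoid_imp_short[OF served[of x]]) (use x1 xl ord in auto)
    then have "t2 - t1 + 2 * j \<le> 1" using x1 ord by (simp add: min_def split: if_splits)
    then show ?thesis by (simp add: j_def)
  qed
  have len: "2 * (M / \<alpha>) - 2 \<le> t2 - t1" using sM ord by linarith
  \<comment> \<open>\<open>len\<close> and \<open>key\<close> at \<open>x = M\<close> would bound
    this sum by 5. As \<open>\<beta> \<le> \<alpha>\<close>, it does not increase with
    \<open>M\<close>, so the worst case is the upper bound \<open>N\<close> from \<open>M2\<close>,
    where \<open>2 \<le> 1 / \<alpha> + \<alpha>\<close> suffices.\<close>
  have "5 < 2 * (M / \<alpha>) + 2 * ((l - M) / \<beta>) + 2 * l"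
  proof -
    define N where "N = 1 / 2 + \<alpha> / 2"
    have "0 \<le> (N - M) * (1 / \<beta> - 1 / \<alpha>)"
      using M2 \<beta>\<alpha> \<beta> by (intro mult_nonneg_nonneg) (auto simp: N_def frac_le)
    then have 1: "N / \<alpha> + (l - N) / \<beta> \<le> M / \<alpha> + (l - M) / \<beta>"
      by (simp add: algebra_simps diff_divide_distrib)
    have "2 \<le> 1 / \<alpha> + \<alpha>"
      using zero_le_power2[of "\<alpha> - 1"] \<alpha>(1) by (simp add: power2_eq_square field_simps)
    moreover have "N / \<alpha> = (1 / \<alpha> + 1) / 2" using \<alpha> by (simp add: N_def field_simps)
    moreover have "1 < 2 * ((l - N) / \<beta>)" using \<beta> long by (simp add: N_def field_simps)
    ultimately show ?thesis using 1 long \<beta>(1) by argo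
  qed
  \<comment> \<open>\<open>key\<close> needs \<open>M < x\<close>. The strict inequality leaves room
    for this: \<open>x < l + \<beta> * K\<close> means
    \<open>- K < (l - x) / \<beta>\<close>.\<close>
  moreover define K where "K = M / \<alpha> + l - 5 / 2"
  ultimately have "- K < (l - M) / \<beta>" by linarith
  then have "M < l + \<beta> * K"
    using \<beta>(1) by (simp add: pos_less_divide_eq algebra_simps)
  moreover have "M < l - \<beta> / 2" using M2 long by argo
  ultimately obtain x where x: "M < x" "x < l - \<beta> / 2" "x < l + \<beta> * K"
    using dense[of M "min (l - \<beta> / 2) (l + \<beta> * K)"] by (metis min_less_iff_conj)
  have "- K < (l - x) / \<beta>"
    using x(3) \<beta>(1) by (simp add: pos_less_divide_eq algebra_simps)
  then show False using key[OF x(1,2)] len unfolding K_def by argo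
qed

section \<open>Trips of the fast agent from the right end to the left end and back\<close>

lemma crossing_time:
  assumes "f s = 0" "f t = l" "0 \<le> s" "0 \<le> t"
  shows "l \<le> \<bar>s - t\<bar>"
  using lipschitz_onD[OF f, of s t] assms l_gt by (simp add: dist_real_def)

text \<open>Used as \<open>1 < l + (l / \<beta> - 1)\<close>: the time \<open>f\<close> needs for a
  crossing plus the margin in \<open>other_agent_misses_left_end\<close>.\<close>

lemma two_crossings: "2 < l + l / \<beta>"
proof -
  have "4 * \<beta> \<le> (1 + \<beta>) * (1 + \<beta>)"
    using zero_le_power2[of "1 - \<beta>"] by (simp add: power2_eq_square algebra_simps)
  also have "\<dots> < 2 * l * (1 + \<beta>)"
    using long \<alpha> \<beta> by (intro mult_strict_right_mono) auto
  finally show ?thesis using \<beta> by (simp add: field_simps)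
qed

context
  fixes \<tau> \<tau>' t
  assumes start: "l / \<alpha> + l / \<beta> \<le> \<tau>" and f\<tau>: "f \<tau> = l" "f \<tau>' = l" "avoids f l \<tau> \<tau>'"
    and ft: "\<tau> < t" "t < \<tau>'" "f t = 0"
    and g\<tau>: "avoids g l \<tau> \<tau>'"
begin

text \<open>With \<open>f\<close> and \<open>g\<close> absent, \<open>h\<close> alone serves the
  right end, and confinement bars it from 0.\<close>

lemma other_agent_misses_left_end: "avoids h 0 (\<tau> + 1 - l / \<beta>) (\<tau>' - 1 + l / \<beta>)"
proof -
  have "0 \<le> \<tau>" "0 \<le> t" "0 \<le> \<tau>'" using start l_gt ft by linarith+
  then have "l \<le> t - \<tau>" "l \<le> \<tau>' - t"
    using crossing_time[of t \<tau>] crossing_time[of t \<tau>'] f\<tau> ft by auto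
  then have "1 < \<tau>' - \<tau>" using l_gt by linarith
  moreover have "1 < 2 * (l / \<beta>)" using l_gt \<beta> by (simp add: field_simps)
  ultimately show ?thesis
    using h f\<tau> g\<tau> l_gt \<open>0 \<le> \<tau>\<close> \<beta>(1)
    by (intro confinement[OF served[of l], where v = \<beta>]) auto
qed

text \<open>Produces the times for \<open>slower_agent_overloaded\<close>: as \<open>h\<close>
  misses 0, \<open>g\<close> must visit it shortly before the first and shortly after the last visit
  of \<open>f\<close> during the trip.\<close>

lemma slower_agent_not_alone_at_right_end: "\<alpha> < \<beta>"
proof -
  have pos: "0 \<le> \<tau>" "0 \<le> t" "0 \<le> \<tau>'" using start l_gt ft by linarith+
  have around: "avoids f 0 (\<tau> - l) (\<tau> + l)" "avoids f 0 (\<tau>' - l) (\<tau>' + l)"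
    using f\<tau> l_gt by (auto intro!: avoids_around[OF f] pos)
  obtain t1 where t1: "\<tau> \<le> t1" "t1 \<le> t" "f t1 = 0" "\<And>w. \<tau> \<le> w \<Longrightarrow> w < t1 \<Longrightarrow> f w \<noteq> 0"
    using first_visit[OF f pos(1) less_imp_le[OF ft(1)] ft(3)] by metis
  obtain t3 where t3: "t \<le> t3" "t3 \<le> \<tau>'" "f t3 = 0" "\<And>w. t3 < w \<Longrightarrow> w \<le> \<tau>' \<Longrightarrow> f w \<noteq> 0"
    using last_visit[OF f pos(2) less_imp_le[OF ft(2)] ft(3)] by metis
  have far: "\<tau> + l \<le> t1" "t3 + l \<le> \<tau>'"
    using crossing_time[of t1 \<tau>] crossing_time[of t3 \<tau>'] t1 t3 f\<tau> pos by auto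
  have f1: "avoids f 0 (\<tau> - l) t1"
    unfolding avoids_def using avoidsD[OF around(1)] t1(4) l_gt(4) by (smt (verit))
  have f3: "avoids f 0 t3 (\<tau>' + l)"
    unfolding avoids_def using avoidsD[OF around(2)] t3(4) l_gt(4) by (smt (verit))
  note h0 = other_agent_misses_left_end
  have "\<exists>u. max (\<tau> - l) (\<tau> + 1 - l / \<beta>) < u \<and> u < t1 \<and> g u = 0"
  proof (rule ccontr)
    assume "\<not> ?thesis"
    then have g0: "avoids g 0 (max (\<tau> - l) (\<tau> + 1 - l / \<beta>)) t1" by (auto simp: avoids_def)
    have "t1 - max (\<tau> - l) (\<tau> + 1 - l / \<beta>) \<le> 1"
      by (rule all_avoid_imp_short[OF served[of 0]])
         (use g0 l_gt start pos t1 t3 far two_crossings in \<open>auto intro: avoids_subset[OF f1] avoids_subset[OF h0]\<close>)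
    then show False using far l_gt two_crossings by linarith
  qed
  then obtain u where u: "\<tau> - l < u" "\<tau> + 1 - l / \<beta> < u" "u < t1" "g u = 0" by auto
  have "\<exists>u. t3 < u \<and> u < min (\<tau>' + l) (\<tau>' - 1 + l / \<beta>) \<and> g u = 0"
  proof (rule ccontr)
    assume "\<not> ?thesis"
    then have g0: "avoids g 0 t3 (min (\<tau>' + l) (\<tau>' - 1 + l / \<beta>))" by (auto simp: avoids_def)
    have "min (\<tau>' + l) (\<tau>' - 1 + l / \<beta>) - t3 \<le> 1"
      by (rule all_avoid_imp_short[OF served[of 0]])
         (use g0 l_gt start pos t1 t3 far two_crossings in \<open>auto intro: avoids_subset[OF f3] avoids_subset[OF h0]\<close>)
    then show False using far l_gt two_crossings by linarith
  qed
  then obtain u' where u': "t3 < u'" "u' < \<tau>' + l" "u' < \<tau>' - 1 + l / \<beta>" "g u' = 0" by auto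
  have u0: "0 \<le> u" "0 \<le> t1" "t1 \<le> u'" using u u' t1 t3 pos start l_gt by linarith+
  \<comment> \<open>\<open>r\<close> and \<open>r'\<close> are the visits of \<open>g\<close> to 0
    nearest to \<open>t1\<close> on either side. \<open>r'\<close> may precede \<open>t3\<close>,
    hence the choice of \<open>t2\<close>.\<close>
  obtain r where r: "u \<le> r" "r \<le> t1" "g r = 0" "\<And>w. r < w \<Longrightarrow> w \<le> t1 \<Longrightarrow> g w \<noteq> 0"
    using last_visit[OF g u0(1) less_imp_le[OF u(3)] u(4)] by metis
  obtain r' where r': "t1 \<le> r'" "r' \<le> u'" "g r' = 0" "\<And>w. t1 \<le> w \<Longrightarrow> w < r' \<Longrightarrow> g w \<noteq> 0"
    using first_visit[OF g u0(2,3) u'(4)] by metis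
  obtain t2 where t2: "t1 \<le> t2" "t2 \<le> r'" "f t2 = 0" "\<And>w. t2 < w \<Longrightarrow> w \<le> r' \<Longrightarrow> f w \<noteq> 0"
    using last_visit[OF f u0(2) r'(1) t1(3)] by metis
  have t23: "t2 \<le> t3"
    using avoidsD[OF f3, of t2] t2 r' u' u0 by force
  have gr: "avoids g 0 r r'"
    unfolding avoids_def using r(4) r'(4) by (metis linorder_not_le less_imp_le)
  have hr: "avoids h 0 r r'" by (rule avoids_subset[OF h0]) (use r r' u u' in auto)
  have "t1 - r \<le> 1"
    by (rule all_avoid_imp_short[OF served[of 0]])
       (use l_gt u0 r r' u in \<open>auto intro: avoids_subset[OF f1] avoids_subset[OF gr] avoids_subset[OF hr]\<close>)
  moreover have "r' - t2 \<le> 1"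
    by (rule all_avoid_imp_short[OF served[of 0]])
       (use l_gt u0 r r' t2 in \<open>auto intro: avoids_subset[OF gr] avoids_subset[OF hr] simp: avoids_def[of f]\<close>)
  moreover have "avoids f l (t1 - l) (t2 + l)" "avoids g l (t1 - l) (t2 + l)"
    by (rule avoids_subset[OF f\<tau>(3)] avoids_subset[OF g\<tau>]; use far t23 in simp)+
  moreover have "1 \<le> t1" "l \<le> t1" using far l_gt start by linarith+
  ultimately show ?thesis
    using slower_agent_overloaded[of r t1 t2 r'] r r' t1 t2 gr hr by auto
qed

text \<open>\<open>h\<close> is tied to the right end and reaches 0 too late to replace
  \<open>f\<close> after \<open>t3\<close>, while \<open>g\<close> stays away.\<close>

lemma same_agent_not_absent_at_both_ends:
  assumes "\<tau> < t3" "t3 < \<tau>'" "\<tau>' < t4" "f t3 = 0" "f t4 = 0" "avoids f 0 t3 t4" "avoids g 0 t3 t4"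
  shows False
proof -
  have pos: "0 \<le> \<tau>" using start l_gt by linarith
  have far: "l \<le> t3 - \<tau>" "l \<le> \<tau>' - t3" "l \<le> t4 - \<tau>'"
    using crossing_time[of t3 \<tau>] crossing_time[of t3 \<tau>'] crossing_time[of t4 \<tau>'] assms f\<tau> pos by auto
  note h0 = other_agent_misses_left_end
  have "min t4 (\<tau>' - 1 + l / \<beta>) - t3 \<le> 1"
    by (rule all_avoid_imp_short[OF served[of 0]])
       (use l_gt pos assms(1) far two_crossings
         in \<open>auto intro: avoids_subset[OF assms(6)] avoids_subset[OF assms(7)] avoids_subset[OF h0]\<close>)
  then show False using far l_gt two_crossings by linarith
qed

end

section \<open>Two overlapping trips and the contradiction\<close>

theorem not_patrolled: False
proof -
  define T where "T = l / \<alpha> + l / \<beta>"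
  have T: "0 \<le> T" using l_gt by (simp add: T_def)
  obtain t1 where t1: "T \<le> t1" "f t1 = l" using fast_agent_visits_right_end by auto
  obtain t where t: "t1 \<le> t" "f t = 0" using fast_agent_visits_left_end by auto
  obtain t2 where t2: "t \<le> t2" "f t2 = l" using fast_agent_visits_right_end by auto
  obtain t3 where t3: "t2 \<le> t3" "f t3 = 0" using fast_agent_visits_left_end by auto
  have pos: "0 \<le> t1" "0 \<le> t" "0 \<le> t2" using t1 t t2 T by auto
  \<comment> \<open>\<open>\<tau>\<close> and \<open>\<tau>'\<close> are consecutive visits to the
    right end around \<open>t\<close>; \<open>s\<close> and \<open>s'\<close> are consecutive visits
    to the left end around \<open>\<tau>'\<close>.\<close>
  obtain \<tau> where \<tau>: "t1 \<le> \<tau>" "\<tau> \<le> t" "f \<tau> = l" "\<And>w. \<tau> < w \<Longrightarrow> w \<le> t \<Longrightarrow> f w \<noteq> l"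
    using last_visit[OF f pos(1) t(1) t1(2)] by metis
  obtain \<tau>' where \<tau>': "t \<le> \<tau>'" "\<tau>' \<le> t2" "f \<tau>' = l" "\<And>w. t \<le> w \<Longrightarrow> w < \<tau>' \<Longrightarrow> f w \<noteq> l"
    using first_visit[OF f pos(2) t2(1) t2(2)] by metis
  have pos': "0 \<le> \<tau>'" "\<tau>' \<le> t3" using pos \<tau>' t3 by auto
  obtain s where s: "t \<le> s" "s \<le> \<tau>'" "f s = 0" "\<And>w. s < w \<Longrightarrow> w \<le> \<tau>' \<Longrightarrow> f w \<noteq> 0"
    using last_visit[OF f pos(2) \<tau>'(1) t(2)] by metis
  obtain s' where s': "\<tau>' \<le> s'" "s' \<le> t3" "f s' = 0" "\<And>w. \<tau>' \<le> w \<Longrightarrow> w < s' \<Longrightarrow> f w \<noteq> 0"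
    using first_visit[OF f pos' t3(2)] by metis
  have ne: "\<tau> < t" "t < \<tau>'" "s < \<tau>'" "\<tau>' < s'" "\<tau> < s"
    using \<tau> \<tau>' s s' t l_gt(4) by (force simp: less_le)+
  have fl: "avoids f l \<tau> \<tau>'"
    unfolding avoids_def using \<tau>(4) \<tau>'(4) by (metis linorder_not_le less_imp_le)
  have f0: "avoids f 0 s s'"
    unfolding avoids_def using s(4) s'(4) by (metis linorder_not_le less_imp_le)
  have st: "l / \<alpha> + l / \<beta> \<le> \<tau>" "l / \<alpha> + l / \<beta> \<le> s" "l / \<beta> + l / \<alpha> \<le> \<tau>" "l / \<beta> + l / \<alpha> \<le> s"
    using t1 \<tau> s t by (auto simp: T_def)
  interpret S: three_agents l \<beta> \<alpha> f h g by (rule swap)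
  interpret R: three_agents l \<alpha> \<beta> "\<lambda>t. l - f t" "\<lambda>t. l - g t" "\<lambda>t. l - h t" by (rule reflect)
  interpret RS: three_agents l \<beta> \<alpha> "\<lambda>t. l - f t" "\<lambda>t. l - h t" "\<lambda>t. l - g t" by (rule S.reflect)
  have refl0: "avoids (\<lambda>t. l - a t) l = avoids a 0" for a
    using reflect_avoids[of a 0] by (intro ext) simp
  have 1: "avoids g l \<tau> \<tau>' \<Longrightarrow> \<alpha> < \<beta>"
    using slower_agent_not_alone_at_right_end[of \<tau> \<tau>' t] st \<tau> \<tau>' fl ne t by simp
  have 2: "avoids h l \<tau> \<tau>' \<Longrightarrow> \<beta> < \<alpha>"
    using S.slower_agent_not_alone_at_right_end[of \<tau> \<tau>' t] st \<tau> \<tau>' fl ne t by simp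
  have 3: "avoids g 0 s s' \<Longrightarrow> \<alpha> < \<beta>"
    using R.slower_agent_not_alone_at_right_end[of s s' \<tau>'] st s s' f0 ne \<tau>' by (simp add: refl0)
  have 4: "avoids h 0 s s' \<Longrightarrow> \<beta> < \<alpha>"
    using RS.slower_agent_not_alone_at_right_end[of s s' \<tau>'] st s s' f0 ne \<tau>' by (simp add: refl0)
  have "avoids g l \<tau> \<tau>' \<or> avoids h l \<tau> \<tau>'" "avoids g 0 s s' \<or> avoids h 0 s s'"
    using no_switch fl f0 st by blast+
  \<comment> \<open>The mixed cases would require both \<open>\<alpha> < \<beta>\<close> and
    \<open>\<beta> < \<alpha>\<close>.\<close>
  then consider "avoids g l \<tau> \<tau>'" "avoids g 0 s s'" | "avoids h l \<tau> \<tau>'" "avoids h 0 s s'"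
    using 1 2 3 4 by fastforce
  then show False
  proof cases
    case 1
    then show False
      using same_agent_not_absent_at_both_ends[of \<tau> \<tau>' t s s'] st \<tau> \<tau>' fl ne t s s' f0 by simp
  next
    case 2
    then show False
      using S.same_agent_not_absent_at_both_ends[of \<tau> \<tau>' t s s'] st \<tau> \<tau>' fl ne t s s' f0 by simp
  qed
qed

end

section \<open>Scaling and ordering by speed\<close>

text \<open>Dividing positions by \<open>u\<close> makes the fastest speed 1 and leaves the unit
  time windows unchanged.\<close>

lemma no_patrol_fastest_first:
  assumes "0 < v" "0 < w" "v \<le> u" "w \<le> u" "(u + v + w) / 2 < l"
    and mot: "agent_motion l u a" "agent_motion l v b" "agent_motion l w c"
    and pat: "\<And>x ts. 0 \<le> x \<Longrightarrow> x \<le> l \<Longrightarrow> 1 \<le> ts \<Longrightarrow> covers a x ts \<or> covers b x ts \<or> covers c x ts"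
  shows False
proof -
  have u: "0 < u" using assms by simp
  have lip: "(v / u)-lipschitz_on {0..} (\<lambda>t. a t / u)"
    if a: "agent_motion l v a" and v: "0 < v" for a v
  proof (rule lipschitz_onI)
    have *: "\<bar>a s - a t\<bar> \<le> v * (t - s)" if "0 \<le> s" "s \<le> t" for s t
    proof (cases "s = t")
      case False
      then have "\<bar>a s - a (s + (t - s))\<bar> \<le> v * (t - s)"
        using a that unfolding agent_motion_def by (meson diff_gt_0_iff_gt order_le_less)
      then show ?thesis by simp
    qed simp
    fix s t :: real assume "s \<in> {0..}" "t \<in> {0..}"
    then have "\<bar>a s - a t\<bar> \<le> v * \<bar>s - t\<bar>"
      using *[of s t] *[of t s] by (cases "s \<le> t") (auto simp: abs_minus_commute)
    then show "dist (a s / u) (a t / u) \<le> v / u * dist s t"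
      using u by (simp add: dist_real_def divide_right_mono flip: diff_divide_distrib)
  qed (use u v in simp)
  have "three_agents (l / u) (v / u) (w / u) (\<lambda>t. a t / u) (\<lambda>t. b t / u) (\<lambda>t. c t / u)"
  proof
    show "1-lipschitz_on {0..} (\<lambda>t. a t / u)" using lip[OF mot(1) u] u by simp
    have "(u + v + w) / 2 / u < l / u" using assms(5) u by (rule divide_strict_right_mono)
    then show "(1 + v / u + w / u) / 2 < l / u" using u by (simp add: add_divide_distrib)
    fix x assume "0 \<le> x" "x \<le> l / u"
    then have x: "0 \<le> x * u" "x * u \<le> l" using u by (auto simp: field_simps)
    show "serves {\<lambda>t. a t / u, \<lambda>t. b t / u, \<lambda>t. c t / u} x 0"
      unfolding serves_def
    proof (intro allI impI)
      fix s :: real assume "0 \<le> s"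
      then show "\<exists>t\<ge>s. t < s + 1 \<and> (\<exists>a\<in>{\<lambda>t. a t / u, \<lambda>t. b t / u, \<lambda>t. c t / u}. a t = x)"
        using pat[OF x, of "s + 1"] u by (fastforce simp: covers_def)
    qed
  qed (use assms u lip in auto)
  then show False by (rule three_agents.not_patrolled)
qed

theorem theorem4:
  fixes v :: "nat \<Rightarrow> real" and l :: real
  assumes "\<forall>i<3. v i > 0"
    and "l > (v 0 + v 1 + v 2) / 2"
  shows "\<not> (\<exists>a. is_strategy l 3 v a \<and> patrols l 3 a)"
proof
  assume "\<exists>a. is_strategy l 3 v a \<and> patrols l 3 a"
  then obtain a where a: "is_strategy l 3 v a" "patrols l 3 a" by blast
  have mot: "agent_motion l (v i) (a i)" if "i < 3" for i
    using a(1) that by (simp add: is_strategy_def)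
  have pos: "0 < v i" if "i < 3" for i using assms(1) that by simp
  have pat: "covers (a 0) x ts \<or> covers (a 1) x ts \<or> covers (a 2) x ts"
    if "0 \<le> x" "x \<le> l" "1 \<le> ts" for x ts
    using a(2) that by (auto simp: patrols_def eval_nat_numeral less_Suc_eq)
  consider "v 1 \<le> v 0" "v 2 \<le> v 0" | "v 0 \<le> v 1" "v 2 \<le> v 1" | "v 0 \<le> v 2" "v 1 \<le> v 2"
    by linarith
  then show False
  proof cases
    case 1
    then show False
      using no_patrol_fastest_first[of "v 1" "v 2" "v 0" l "a 0" "a 1" "a 2"] assms(2) mot pos pat by simp
  next
    case 2
    then show False
      using no_patrol_fastest_first[of "v 0" "v 2" "v 1" l "a 1" "a 0" "a 2"] assms(2) mot pos pat
      by (simp add: ac_simps)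
  next
    case 3
    then show False
      using no_patrol_fastest_first[of "v 0" "v 1" "v 2" l "a 2" "a 0" "a 1"] assms(2) mot pos pat
      by (simp add: ac_simps)
  qed
qed

end
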